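(* There exist controlled Markov chains $\{(X_i,a_i)\}$, on some state space $\chi$ and control space $\mathbb I$, such that for every nonempty proper measurable subset $S\subsetneq\chi\times\mathbb I$ one has $T(S)<\infty$, and yet $\nu(S)$ does not exist, i.e. the limit $\lim_{n\to\infty}\nu_n(S)$ does not exist.
   Context: The process $\{(X_i,a_i)\}_{i\ge0}$ is defined on a filtered probability space $(\Omega,\mathcal F,\{\mathcal F_i\}_{i\ge0},\mathbb P)$, adapted, with states $X_i\in\chi\subset\mathbb R^{d_1}$ and controls $a_i\in\mathbb I\subset\mathbb R^{d_2}$; $\chi,\mathbb I$ are compact (possibly finite) and $\mu_\chi$ is a reference measure on $\chi$ (Lebesgue if continuous, counting if discrete). It is a controlled Markov chain if, for some transition function $s$, $\mathbb P(X_{i+1}\in dy\mid X_0,a_0,\dots,X_i,a_i)=s(X_i,a_i,y)\mu_\chi(dy)$ for all $i$. $\nu_n(S)=\frac1n\sum_{i=1}^n\mathbb P((X_i,a_i)\in S)$ and $\nu(S)=\lim_{n\to\infty}\nu_n(S)$ (the ergodic occupation measure, when the limit exists). Return times: $\tau_S^{(0)}=0$; $\tau_S^{(1)}=\min\{n\ge0:(X_n,a_n)\in S\}$; for $i\ge2$, $\tau_S^{(i)}$ is the smallest $n\ge1$ with $(X_{\sigma+n},a_{\sigma+n})\in S$, where $\sigma=\sum_{k=1}^{i-1}\tau_S^{(k)}$. $T(S)=\sup_{i\ge1}\mathbb E\big[\tau_S^{(i)}\mid\mathcal F_{\sum_{p=0}^{i-1}\tau_S^{(p)}}\big]$ (essential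 supremum). *)

theory Defs
  imports "HOL-Probability.Probability"
begin

text \<open>Counting measure on a countable state space, Lebesgue measure (on Borel sets) otherwise.
  In the countable case every subset is Borel, so both branches carry the Borel
  sigma-algebra of the state space.\<close>

definition reference_measure :: "'x::euclidean_space set \<Rightarrow> 'x measure" where
  "reference_measure \<X> = (if countable \<X> then count_space \<X> else restrict_space lborel \<X>)"

definition transition_function ::
  "'x::euclidean_space set \<Rightarrow> 'u::euclidean_space set \<Rightarrow> ('x \<Rightarrow> 'u \<Rightarrow> 'x \<Rightarrow> real) \<Rightarrow> bool" where
  "transition_function \<X> \<I> s \<longleftrightarrow>
     (\<lambda>((x, u), y). s x u y)
        \<in> borel_measurable (restrict_space borel (\<X> \<times> \<I>) \<Otimes>\<^sub>M reference_measure \<X>) \<and>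
     (\<forall>x\<in>\<X>. \<forall>u\<in>\<I>. \<forall>y\<in>\<X>. 0 \<le> s x u y) \<and>
     (\<forall>x\<in>\<X>. \<forall>u\<in>\<I>. (\<integral>\<^sup>+y. ennreal (s x u y) \<partial>reference_measure \<X>) = 1)"

text \<open>The sigma-algebra generated by \<open>Z 0, \<dots>, Z i\<close>.\<close>

definition history :: "'w measure \<Rightarrow> (nat \<Rightarrow> 'w \<Rightarrow> 'z::topological_space) \<Rightarrow> nat \<Rightarrow> 'w measure" where
  "history M Z i = sigma (space M) {Z j -` B \<inter> space M | j B. j \<le> i \<and> B \<in> sets borel}"

locale controlled_process = prob_space M + filtration "space M" F
  for M :: "'w measure" and F :: "nat \<Rightarrow> 'w measure" +
  fixes \<X> :: "'x::euclidean_space set" and \<I> :: "'u::euclidean_space set"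
    and X :: "nat \<Rightarrow> 'w \<Rightarrow> 'x" and a :: "nat \<Rightarrow> 'w \<Rightarrow> 'u"
  assumes subalgebra_F: "\<And>i. subalgebra M (F i)"
    and compact_states: "compact \<X>"
    and compact_controls: "compact \<I>"
    and adapted_state: "\<And>i. X i \<in> F i \<rightarrow>\<^sub>M restrict_space borel \<X>"
    and adapted_control: "\<And>i. a i \<in> F i \<rightarrow>\<^sub>M restrict_space borel \<I>"

text \<open>The measure \<open>density (reference_measure \<X>) (s x u)\<close> is \<open>s(x, u, y) \<mu>(dy)\<close>.\<close>

locale controlled_markov_chain = controlled_process +
  assumes controlled_markov:
    "\<exists>s. transition_function \<X> \<I> s \<and>
       (\<forall>i. \<forall>B \<in> sets (reference_measure \<X>). AE \<omega> in M.
          real_cond_exp M (history M (\<lambda>j \<omega>. (X j \<omega>, a j \<omega>)) i)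
            (indicator (X (Suc i) -` B \<inter> space M)) \<omega> =
          measure (density (reference_measure \<X>) (\<lambda>y. ennreal (s (X i \<omega>) (a i \<omega>) y))) B)"

definition occupation :: "'w measure \<Rightarrow> (nat \<Rightarrow> 'w \<Rightarrow> 'z) \<Rightarrow> 'z set \<Rightarrow> nat \<Rightarrow> real" where
  "occupation M Z S n = (1 / real n) * (\<Sum>i = 1..n. measure M {\<omega> \<in> space M. Z i \<omega> \<in> S})"

text \<open>Return times along a single trajectory \<open>z\<close>, with \<open>Inf {} = \<infinity>\<close> if \<open>S\<close> is not hit (again).\<close>

fun return_time :: "(nat \<Rightarrow> 'z) \<Rightarrow> 'z set \<Rightarrow> nat \<Rightarrow> enat" where
  "return_time z S 0 = 0"
| "return_time z S (Suc 0) = Inf {enat n | n. z n \<in> S}"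
| "return_time z S (Suc (Suc k)) =
     (case (\<Sum>j = 1..Suc k. return_time z S j) of
        \<infinity> \<Rightarrow> \<infinity>
      | enat m \<Rightarrow> Inf {enat n | n. 1 \<le> n \<and> z (m + n) \<in> S})"

text \<open>The sigma-algebra of a stopping time. The library's version requires the stopping time to
  take values in the index set of the filtration, which excludes the value \<open>\<infinity>\<close>.\<close>

definition stopped_algebra ::
  "'w measure \<Rightarrow> (nat \<Rightarrow> 'w measure) \<Rightarrow> ('w \<Rightarrow> enat) \<Rightarrow> 'w measure" where
  "stopped_algebra M F T =
     sigma (space M) {A \<in> sets M. \<forall>n. {\<omega> \<in> A. T \<omega> \<le> enat n} \<in> sets (F n)}"

definition max_return_time ::
  "'w measure \<Rightarrow> (nat \<Rightarrow> 'w measure) \<Rightarrow> (nat \<Rightarrow> 'w \<Rightarrow> 'z) \<Rightarrow> 'z set \<Rightarrow> ennreal" where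
  "max_return_time M F Z S =
     (SUP i \<in> {1..}. esssup M
        (nn_cond_exp M
           (stopped_algebra M F (\<lambda>\<omega>. \<Sum>p = 0..i - 1. return_time (\<lambda>n. Z n \<omega>) S p))
           (\<lambda>\<omega>. ennreal_of_enat (return_time (\<lambda>n. Z n \<omega>) S i))))"

end

theory Submission
  imports Defs "HOL-Library.Discrete_Functions"
begin

text \<open>Randomness is not needed: a single state and two controls played in a deterministic order
  form a controlled Markov chain whose sample space has one point. The controls are played in blocks
  of three, \<open>True, False, c\<close>, so that both recur within three steps, while the bit \<open>c\<close> is constant on
  dyadic ranges of block numbers and alternates between consecutive ranges. If the frequency of a
  control along \<open>n = 3 * 2 ^ j\<close> converged to \<open>L\<close>, its frequency on the \<open>j\<close>-th dyadic range would
  converge to \<open>2 * L - L\<close>, whereas that frequency alternates between \<open>1 / 3\<close> and \<open>2 / 3\<close>.\<close>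

text \<open>Block \<open>k\<close> occupies the times \<open>3 * k + 1\<close> to
  \<open>3 * k + 3\<close>, because \<open>occupation\<close> counts from time 1; hence
  \<open>(i - 1) div 3\<close> is the block number. Time 0 lies in no block and affects no
  frequency.\<close>

definition dyadic_control :: "nat \<Rightarrow> bool" where
  "dyadic_control i \<longleftrightarrow> i mod 3 = 1 \<or> i mod 3 = 0 \<and> even (floor_log ((i - 1) div 3))"

lemma dyadic_control_triple:
  "dyadic_control (3 * k + 1)"
  "\<not> dyadic_control (3 * k + 2)"
  "dyadic_control (3 * k + 3) \<longleftrightarrow> even (floor_log k)"
proof -
  show "dyadic_control (3 * k + 1)"
    by (simp add: dyadic_control_def)
  have "(3 * k + 2) mod 3 = 2"
    by presburger
  then show "\<not> dyadic_control (3 * k + 2)"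
    by (simp add: dyadic_control_def)
  have "(3 * k + 3) mod 3 = 0" "(3 * k + 3 - 1) div 3 = k"
    by presburger+
  then show "dyadic_control (3 * k + 3) \<longleftrightarrow> even (floor_log k)"
    unfolding dyadic_control_def by presburger
qed

text \<open>Three consecutive times meet every residue modulo 3, and the residues 1 and 2 already
  force \<open>True\<close> and \<open>False\<close>, whatever the varying bit does.\<close>

lemma dyadic_control_within_three: "\<exists>n\<in>{1..3}. dyadic_control (m + n) = p"
proof -
  define r :: nat where "r = (if p then 1 else 2)"
  have *: "dyadic_control i = p" if "i mod 3 = r" for i
    using that by (auto simp: dyadic_control_def r_def split: if_splits)
  have "(m + 1) mod 3 = r \<or> (m + 2) mod 3 = r \<or> (m + 3) mod 3 = r"
    unfolding r_def by (cases p; simp; presburger)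
  then show ?thesis
    using * by fastforce
qed

lemma sum_triples:
  fixes f :: "nat \<Rightarrow> 'a::comm_monoid_add"
  shows "(\<Sum>i = 1..3 * n. f i) = (\<Sum>k<n. f (3 * k + 1) + f (3 * k + 2) + f (3 * k + 3))"
proof (induction n)
  case (Suc n)
  have "3 * Suc n = Suc (Suc (Suc (3 * n)))" "3 * n + 1 = Suc (3 * n)"
    "3 * n + 2 = Suc (Suc (3 * n))" "3 * n + 3 = Suc (Suc (Suc (3 * n)))"
    by simp_all
  then show ?case
    by (simp only: sum.lessThan_Suc sum.cl_ivl_Suc Suc.IH[symmetric]) (simp add: add.assoc)
qed simp

lemma dyadic_control_frequency_divergent:
  "\<not> convergent (\<lambda>n. (\<Sum>i = 1..n. of_bool (dyadic_control i = p)) / real n)"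
proof
  define f :: "nat \<Rightarrow> real" where "f i = of_bool (dyadic_control i = p)" for i
  \<comment> \<open>\<open>g k\<close> counts the occurrences of \<open>p\<close> in block
    \<open>k\<close>: one from the pair \<open>True, False\<close>, and another if the bit equals
    \<open>p\<close>.\<close>
  define g :: "nat \<Rightarrow> real" where "g k = 1 + of_bool (even (floor_log k) = p)" for k
  define A where "A j = (\<Sum>k<2 ^ j. g k)" for j :: nat
  have g: "f (3 * k + 1) + f (3 * k + 2) + f (3 * k + 3) = g k" for k
    using dyadic_control_triple[of k] unfolding f_def g_def by (cases p) simp_all
  have A: "(\<Sum>i = 1..3 * 2 ^ j. f i) = A j" for j
    unfolding A_def sum_triples g ..
  have step: "A (Suc j) - A j = 2 ^ j * (1 + of_bool (even j = p))" for j
  proof -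
    have "A (Suc j) - A j = (\<Sum>k \<in> {2 ^ j..<2 ^ Suc j}. g k)"
      unfolding A_def lessThan_atLeast0 by (rule sum_diff_nat_ivl) auto
    also have "\<dots> = (\<Sum>k \<in> {2 ^ j..<2 ^ Suc j::nat}. 1 + of_bool (even j = p))"
    proof (rule sum.cong)
      fix k :: nat assume "k \<in> {2 ^ j..<2 ^ Suc j}"
      then have "floor_log k = j"
        by (intro floor_log_eqI) (auto intro: less_le_trans[of 0 "2 ^ j"])
      then show "g k = 1 + of_bool (even j = p)"
        by (simp add: g_def)
    qed simp
    finally show ?thesis
      by simp
  qed
  assume "convergent (\<lambda>n. (\<Sum>i = 1..n. of_bool (dyadic_control i = p)) / real n)"
  then obtain L where L: "(\<lambda>n. (\<Sum>i = 1..n. f i) / real n) \<longlonglongrightarrow> L"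
    unfolding convergent_def f_def by blast
  have "strict_mono (\<lambda>j::nat. 3 * 2 ^ j :: nat)"
    by (simp add: strict_mono_def)
  from LIMSEQ_subseq_LIMSEQ[OF L this] have lim: "(\<lambda>j. A j / (3 * 2 ^ j)) \<longlonglongrightarrow> L"
    by (simp add: o_def A del: One_nat_def)
  \<comment> \<open>The coefficients cancel the denominators and leave
    \<open>(A (Suc j) - A j) / 2 ^ j\<close>, the mean of \<open>g\<close> over the
    \<open>j\<close>-th dyadic range.\<close>
  have "(\<lambda>j. 6 * (A (Suc j) / (3 * 2 ^ Suc j)) - 3 * (A j / (3 * 2 ^ j))) \<longlonglongrightarrow> 6 * L - 3 * L"
    by (intro tendsto_intros lim LIMSEQ_Suc[OF lim])
  moreover have "6 * (A (Suc j) / (3 * 2 ^ Suc j)) - 3 * (A j / (3 * 2 ^ j))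
      = 1 + of_bool (even j = p)" for j
    using step[of j] by (simp add: field_simps)
  ultimately have *: "(\<lambda>j. 1 + of_bool (even j = p)) \<longlonglongrightarrow> 6 * L - 3 * L"
    by simp
  \<comment> \<open>Along even and along odd \<open>j\<close> the sequence is constant, with the
    distinct values 1 and 2, which contradicts uniqueness of the limit.\<close>
  have "strict_mono (\<lambda>j::nat. 2 * j)" "strict_mono (\<lambda>j::nat. 2 * j + 1)"
    by (simp_all add: strict_mono_def)
  from this[THEN LIMSEQ_subseq_LIMSEQ[OF *]] show False
    by (cases p) (simp_all add: o_def LIMSEQ_const_iff)
qed

lemma sum_enat_neq_infinity:
  fixes f :: "'a \<Rightarrow> enat"
  assumes "\<And>x. x \<in> A \<Longrightarrow> f x \<noteq> \<infinity>"
  shows "sum f A \<noteq> \<infinity>"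
  using assms by (induction A rule: infinite_finite_induct) (simp_all add: plus_eq_infty_iff_enat)

text \<open>By strong induction all earlier return times are finite, so the next search starts at a
  finite time \<open>m\<close> and the gap hypothesis applies there. The first search also admits
  \<open>n = 0\<close>, which only lowers the infimum.\<close>

lemma return_time_le:
  assumes "\<And>m. \<exists>n\<in>{1..N}. z (m + n) \<in> S"
  shows "return_time z S i \<le> enat N"
proof (induction i rule: less_induct)
  case (less i)
  have Inf_le: "Inf {enat n | n. P n} \<le> enat N" if "\<exists>n\<le>N. P n" for P
    using that by (auto intro: Inf_lower2)
  consider "i = 0" | "i = Suc 0" | k where "i = Suc (Suc k)"
    by (metis not0_implies_Suc)
  then show ?case
  proof cases
    case 2
    then show ?thesis
      using assms[of 0] by (auto intro!: Inf_le)
  next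
    case 3
    have "return_time z S j \<noteq> \<infinity>" if "j \<in> {1..Suc k}" for j
      using less[of j] 3 that by (cases "return_time z S j") auto
    then have "(\<Sum>j = 1..Suc k. return_time z S j) \<noteq> \<infinity>"
      by (rule sum_enat_neq_infinity)
    then obtain m where m: "(\<Sum>j = 1..Suc k. return_time z S j) = enat m"
      by blast
    have "return_time z S i = Inf {enat n | n. 1 \<le> n \<and> z (m + n) \<in> S}"
      unfolding 3 return_time.simps m by simp
    also have "\<dots> \<le> enat N"
      using assms[of m] by (intro Inf_le) auto
    finally show ?thesis .
  qed (simp add: zero_enat_def[symmetric])
qed

text \<open>A one-point space carries only one sigma-algebra. Histories and stopped algebras
  therefore never have to be computed: knowing their space is enough.\<close>

lemma sets_singleton_space:
  assumes "space N = {w}"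
  shows "sets N = Pow {w}"
proof
  show "sets N \<subseteq> Pow {w}"
    using sets.sets_into_space[of _ N] assms by auto
  show "Pow {w} \<subseteq> sets N"
    using sets.top[of N] assms by (auto simp: subset_singleton_iff)
qed

lemma measurable_singleton_space:
  assumes "space N = {w}" "f w \<in> space K"
  shows "f \<in> N \<rightarrow>\<^sub>M K"
  using assms by (auto simp: measurable_def sets_singleton_space)

lemma prob_space_count_space_singleton: "prob_space (count_space {w})"
  by (rule prob_spaceI) simp

lemma subalgebra_count_space_singleton:
  assumes "space N = {w}"
  shows "subalgebra (count_space {w}) N"
  using assms by (simp add: subalgebra_def sets_singleton_space)

lemma sigma_finite_subalgebra_count_space_singleton:
  assumes "space N = {w}"
  shows "sigma_finite_subalgebra (count_space {w}) N"
proof -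
  interpret prob_space "count_space {w}"
    by (rule prob_space_count_space_singleton)
  show ?thesis
    using assms
    by (intro finite_measure_subalgebra_is_sigma_finite finite_measure_subalgebra.intro
        finite_measure_axioms finite_measure_subalgebra_axioms.intro
        subalgebra_count_space_singleton)
qed

text \<open>The trajectory is deterministic, so each return time is a constant and equals its own
  conditional expectation; the pathwise bound carries over.\<close>

lemma max_return_time_singleton_le:
  assumes "\<And>m. \<exists>n\<in>{1..N}. z (m + n) \<in> S"
  shows "max_return_time (count_space {w}) F (\<lambda>i _. z i) S \<le> of_nat N"
  unfolding max_return_time_def
proof (rule SUP_least, rule esssup_I)
  fix i
  let ?G = "stopped_algebra (count_space {w}) F (\<lambda>_. \<Sum>p = 0..i - 1. return_time z S p)"
  let ?f = "\<lambda>_ :: 'b. ennreal_of_enat (return_time z S i)"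
  have G: "space ?G = {w}"
    by (simp only: stopped_algebra_def space_measure_of_conv space_count_space)
  interpret sigma_finite_subalgebra "count_space {w}" ?G
    using G by (rule sigma_finite_subalgebra_count_space_singleton)
  have "ennreal_of_enat (return_time z S i) \<le> ennreal_of_enat (enat N)"
    unfolding ennreal_of_enat_le_iff using assms by (rule return_time_le)
  then show "AE \<omega> in count_space {w}. nn_cond_exp (count_space {w}) ?G ?f \<omega> \<le> of_nat N"
    using nn_cond_exp_F_meas[of ?f] by (auto simp: AE_count_space)
qed simp

text \<open>With a single state the next state is certain under any control sequence, so the
  constant density 1 against counting measure serves as transition function. Both sides of the
  Markov property reduce to whether \<open>x0\<close> lies in \<open>B\<close>.\<close>

lemma controlled_markov_chain_singleton:
  fixes x0 :: "'x::euclidean_space" and u :: "nat \<Rightarrow> 'u::euclidean_space"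
  assumes \<I>: "compact \<I>" "range u \<subseteq> \<I>"
  shows "controlled_markov_chain (count_space {w}) (\<lambda>_. count_space {w})
    {x0} \<I> (\<lambda>_ _. x0) (\<lambda>i _. u i)"
proof -
  interpret prob_space "count_space {w}"
    by (rule prob_space_count_space_singleton)
  let ?Z = "\<lambda>j (\<omega>::'a). (x0, u j)"
  have ref: "reference_measure {x0} = count_space {x0}"
    by (simp add: reference_measure_def)
  have tf: "transition_function {x0} \<I> (\<lambda>_ _ _. 1)"
    by (simp add: transition_function_def ref case_prod_unfold)
  have H: "AE \<omega> in count_space {w}. real_cond_exp (count_space {w}) (history (count_space {w}) ?Z i)
      (indicator ((\<lambda>_. x0) -` B \<inter> space (count_space {w}))) \<omega>
      = measure (density (reference_measure {x0}) (\<lambda>y. ennreal 1)) B"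
    if "B \<in> sets (reference_measure {x0})" for i B
  proof -
    have B: "B = {} \<or> B = {x0}"
      using that by (auto simp: ref)
    have h: "space (history (count_space {w}) ?Z i) = {w}"
      by (simp add: history_def space_measure_of_conv)
    interpret sigma_finite_subalgebra "count_space {w}" "history (count_space {w}) ?Z i"
      using h by (rule sigma_finite_subalgebra_count_space_singleton)
    let ?f = "indicator ((\<lambda>_. x0) -` B \<inter> {w}) :: 'a \<Rightarrow> real"
    have "AE \<omega> in count_space {w}.
        real_cond_exp (count_space {w}) (history (count_space {w}) ?Z i) ?f \<omega> = ?f \<omega>"
      by (intro real_cond_exp_F_meas measurable_singleton_space[OF h] integrable_count_space) auto
    moreover have "?f w = measure (density (reference_measure {x0}) (\<lambda>y. ennreal 1)) B"
      using B by (auto simp: ref density_1)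
    ultimately show ?thesis
      by (simp add: AE_count_space)
  qed
  show ?thesis
  proof
    show "\<exists>s. transition_function {x0} \<I> s \<and>
       (\<forall>i. \<forall>B \<in> sets (reference_measure {x0}). AE \<omega> in count_space {w}.
          real_cond_exp (count_space {w}) (history (count_space {w}) ?Z i)
            (indicator ((\<lambda>_. x0) -` B \<inter> space (count_space {w}))) \<omega> =
          measure (density (reference_measure {x0}) (\<lambda>y. ennreal (s x0 (u i) y))) B)"
      using tf H by (intro exI[of _ "\<lambda>_ _ _. 1"]) blast
  qed (use \<I> in \<open>auto simp: subalgebra_def space_restrict_space\<close>)
qed

theorem lemma4:
  shows "\<exists>(M :: (nat \<Rightarrow> (real ^ 'd1) \<times> (real ^ 'd2)) measure) F
      (\<X> :: (real ^ 'd1) set) (\<I> :: (real ^ 'd2) set) X a.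
    controlled_markov_chain M F \<X> \<I> X a \<and>
    (\<exists>S \<in> sets borel. S \<noteq> {} \<and> S \<subset> \<X> \<times> \<I>) \<and>
    (\<forall>S \<in> sets borel. S \<noteq> {} \<and> S \<subset> \<X> \<times> \<I> \<longrightarrow>
       max_return_time M F (\<lambda>i \<omega>. (X i \<omega>, a i \<omega>)) S < \<infinity> \<and>
       \<not> convergent (occupation M (\<lambda>i \<omega>. (X i \<omega>, a i \<omega>)) S))"
proof -
  \<comment> \<open>The two controls are encoded as the zero vector and the all-ones vector.\<close>
  define u :: "nat \<Rightarrow> real ^ 'd2" where "u i = of_bool (dyadic_control i)" for i
  define z :: "nat \<Rightarrow> (real ^ 'd1) \<times> (real ^ 'd2)" where "z i = (0, u i)" for i
  let ?M = "count_space {undefined} :: (nat \<Rightarrow> (real ^ 'd1) \<times> (real ^ 'd2)) measure"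
  have "controlled_markov_chain ?M (\<lambda>_. ?M) {0} {0, 1} (\<lambda>_ _. 0) (\<lambda>i _. u i)"
    by (rule controlled_markov_chain_singleton) (auto simp: u_def)
  moreover have "\<exists>S \<in> sets borel. S \<noteq> {} \<and> S \<subset> ({0} :: (real ^ 'd1) set) \<times> ({0, 1} :: (real ^ 'd2) set)"
    by (rule bexI[of _ "{(0, 0)}"]) auto
  moreover have "max_return_time ?M (\<lambda>_. ?M) (\<lambda>i _. z i) S < \<infinity> \<and>
      \<not> convergent (occupation ?M (\<lambda>i _. z i) S)"
    if S: "S \<noteq> {}" "S \<subset> {0} \<times> {0, 1}" for S
  proof -
    \<comment> \<open>The product has just two points, so only singletons remain, and visiting
      \<open>S\<close> means playing one fixed control \<open>p\<close>.\<close>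
    have "S = {(0, 0)} \<or> S = {(0, 1)}"
      using S by auto
    then obtain p where p: "S = {(0, of_bool p)}"
      by (metis of_bool_eq(1,2))
    have mem: "z i \<in> S \<longleftrightarrow> dyadic_control i = p" for i
      by (auto simp: p z_def u_def)
    have "max_return_time ?M (\<lambda>_. ?M) (\<lambda>i _. z i) S \<le> of_nat 3"
      using dyadic_control_within_three by (intro max_return_time_singleton_le) (simp only: mem)
    also have "\<dots> < \<infinity>"
      by simp
    finally have "max_return_time ?M (\<lambda>_. ?M) (\<lambda>i _. z i) S < \<infinity>" .
    moreover have "occupation ?M (\<lambda>i _. z i) S
        = (\<lambda>n. (\<Sum>i = 1..n. of_bool (dyadic_control i = p)) / real n)"
    proof -
      have "measure ?M {\<omega> \<in> space ?M. z i \<in> S} = of_bool (dyadic_control i = p)" for i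
        by (cases "z i \<in> S") (simp_all add: mem)
      then show ?thesis
        by (simp add: occupation_def fun_eq_iff del: sum_of_bool_eq)
    qed
    ultimately show ?thesis
      using dyadic_control_frequency_divergent[of p] by simp
  qed
  ultimately show ?thesis
    unfolding z_def by blast
qed

end
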